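(* Let $n,q$ be positive integers. Assume that the tropical holomorphic map $f=[f_0:\dots:f_n]:\mathbb{R}\to\mathbb{TP}^n$ (with reduced representation $(f_0,\dots,f_n)$) is tropically linearly nondegenerate. If $H_1,\dots,H_q$ are tropical hyperplanes in $\mathbb{TP}^n$ in general position, defined by tropical linear polynomials $P_1,\dots,P_q$ respectively, then $$(q-n-1)\,T_f(r)\le\sum_{j=1}^q N\bigl(r,1_{\mathbb{T}}\oslash(P_j\circ f)\bigr)-\sum_{j=0}^n N(r,1_{\mathbb{T}}\oslash f_j)+O(1)$$ for every $r$ (no growth condition on $f$ and no exceptional set), where $O(1)$ denotes a quantity bounded independently of $r$.
   Context: Tropical semiring: $\mathbb{T}=\mathbb{R}\cup\{-\infty\}$, $x\oplus y=\max(x,y)$, $x\otimes y=x+y$, $x\oslash y=x-y$, $0_{\mathbb{T}}=-\infty$, $1_{\mathbb{T}}=0$. Tropical projective space $\mathbb{TP}^n$ is $\mathbb{T}^{n+1}\setminus\{(0_{\mathbb{T}},\dots,0_{\mathbb{T}})\}$ modulo $(a_0,\dots,a_n)\sim(\lambda+a_0,\dots,\lambda+a_n)$, $\lambda\in\mathbb{R}$. Hyperplanes: a tropical linear polynomial is $P(x)=\max_{0\le i\le n}(a_i+x_i)$ with coefficient vector $a=(a_0,\dots,a_n)\in\mathbb{T}^{n+1}$ not all $0_{\mathbb{T}}$. The tropical hyperplane it defines is $H=\{x\in\mathbb{TP}^n:\ \max_i(a_i+x_i)\text{ is attained at least twice}\}$ (in particular $x\in H$ if all terms are $-\infty$). $H_1,\dots,H_q$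 are in general position if $H_{\mu(0)}\cap\dots\cap H_{\mu(n)}=\varnothing$ for every injective map $\mu:\{0,\dots,n\}\to\{1,\dots,q\}$. Functions: a tropical meromorphic function is a continuous piecewise linear $g:\mathbb{R}\to\mathbb{R}$. Put $\omega_g(x)=\lim_{\varepsilon\to0^+}(g'(x+\varepsilon)-g'(x-\varepsilon))$; $x$ is a root of multiplicity $\omega_g(x)$ if $\omega_g(x)>0$, and a pole of multiplicity $-\omega_g(x)$ if $\omega_g(x)<0$. A tropical entire function is a tropical meromorphic function without poles. The counting function is $N(r,g)=\frac12\int_0^r n(t,g)\,dt$ with $n(t,g)=\sum_{|s|\le t,\ \omega_g(s)<0}|\omega_g(s)|$ (poles); thus $N(r,1_{\mathbb{T}}\oslash g)=N(r,-g)$ counts the roots of $g$. Curves: a tropical holomorphic map (curve) $f=[f_0:\dots:f_n]:\mathbb{R}\to\mathbb{TP}^n$ is given by tropical entire functions $f_0,\dots,f_n$ without any common roots (reduced representation). Put $\|f(x)\|=\max_i f_i(x)$, $T_f(r)=\frac12(\|f(r)\|+\|f(-r)\|)-\|f(0)\|$, and $P\circ f=\max_i(a_i+f_i)$. The map $f$ is tropically linearly nondegenerate if $f(\mathbb{R})$ is not contained in any tropical hyperplane of $\mathbb{TP}^n$.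
   Formalization: The formal theorem assumes in addition that q = 1 or q ≥ n+1; for 2 ≤ q ≤ n general position as defined is vacuous and the claim fails, e.g. when all P_j = x_0, f_0 = 0 and f_1,…,f_n interpolate x² on shifted integer grids. *)

theory Defs
  imports "HOL-Analysis.Analysis"
begin

(* The tropical semiring is the set of all x :: ereal with x \<noteq> \<infinity>; on it, tropical addition is
   max and tropical multiplication is +. A tuple indexed by 0..n is a function on nat of which
   only the values at i \<le> n matter. *)

definition trop_vec :: "nat \<Rightarrow> (nat \<Rightarrow> ereal) set" where
  "trop_vec n = {x. (\<forall>i\<le>n. x i \<noteq> \<infinity>) \<and> (\<exists>i\<le>n. x i \<noteq> -\<infinity>)}"

(* Tuples agreeing on 0..n are related (take c = 0), so the quotient does not see the values
   beyond n. *)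

definition proj_rel :: "nat \<Rightarrow> ((nat \<Rightarrow> ereal) \<times> (nat \<Rightarrow> ereal)) set" where
  "proj_rel n = {(x, y). x \<in> trop_vec n \<and> y \<in> trop_vec n \<and>
                   (\<exists>c::real. \<forall>i\<le>n. y i = ereal c + x i)}"

definition trop_proj :: "nat \<Rightarrow> (nat \<Rightarrow> ereal) set set" where
  "trop_proj n = trop_vec n // proj_rel n"

definition proj_point :: "nat \<Rightarrow> (nat \<Rightarrow> ereal) \<Rightarrow> (nat \<Rightarrow> ereal) set" where
  "proj_point n x = proj_rel n `` {x}"

definition trop_linear :: "nat \<Rightarrow> (nat \<Rightarrow> ereal) \<Rightarrow> (nat \<Rightarrow> ereal) \<Rightarrow> ereal" where
  "trop_linear n a x = (MAX i\<in>{..n}. a i + x i)"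

definition attained_twice :: "nat \<Rightarrow> (nat \<Rightarrow> ereal) \<Rightarrow> (nat \<Rightarrow> ereal) \<Rightarrow> bool" where
  "attained_twice n a x \<longleftrightarrow>
     (\<exists>i\<le>n. \<exists>j\<le>n. i \<noteq> j \<and> a i + x i = trop_linear n a x \<and> a j + x j = trop_linear n a x)"

definition trop_hyperplane :: "nat \<Rightarrow> (nat \<Rightarrow> ereal) \<Rightarrow> (nat \<Rightarrow> ereal) set set" where
  "trop_hyperplane n a =
     {p \<in> trop_proj n. \<exists>x \<in> trop_vec n. p = proj_point n x \<and> attained_twice n a x}"

(* This is vacuously true if q \<le> n. *)

definition general_position :: "nat \<Rightarrow> nat \<Rightarrow> (nat \<Rightarrow> (nat \<Rightarrow> ereal) set set) \<Rightarrow> bool" where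
  "general_position n q H \<longleftrightarrow>
     (\<forall>\<mu>::nat \<Rightarrow> nat. inj_on \<mu> {0..n} \<and> \<mu> ` {0..n} \<subseteq> {1..q} \<longrightarrow> (\<Inter>i\<in>{0..n}. H (\<mu> i)) = {})"

(* Infinitely many breakpoints (contained in B) are allowed, but only finitely many in each
   bounded interval. *)

definition trop_meromorphic :: "(real \<Rightarrow> real) \<Rightarrow> bool" where
  "trop_meromorphic g \<longleftrightarrow> continuous_on UNIV g \<and>
     (\<exists>B. (\<forall>r. finite (B \<inter> {-r..r})) \<and>
          (\<forall>a b. {a<..<b} \<inter> B = {} \<longrightarrow> (\<exists>m c. \<forall>x\<in>{a<..<b}. g x = m * x + c)))"

definition slope_jump :: "(real \<Rightarrow> real) \<Rightarrow> real \<Rightarrow> real" where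
  "slope_jump g x = Lim (at_right 0) (\<lambda>\<epsilon>. deriv g (x + \<epsilon>) - deriv g (x - \<epsilon>))"

definition trop_root :: "(real \<Rightarrow> real) \<Rightarrow> real \<Rightarrow> bool" where
  "trop_root g x \<longleftrightarrow> slope_jump g x > 0"

definition trop_pole :: "(real \<Rightarrow> real) \<Rightarrow> real \<Rightarrow> bool" where
  "trop_pole g x \<longleftrightarrow> slope_jump g x < 0"

definition trop_entire :: "(real \<Rightarrow> real) \<Rightarrow> bool" where
  "trop_entire g \<longleftrightarrow> trop_meromorphic g \<and> (\<nexists>x. trop_pole g x)"

(* Number of poles in [-t, t]; the tropical reciprocal of g is -g, so the roots of g are counted
   by applying this, or N_count below, to -g. *)

definition n_count :: "real \<Rightarrow> (real \<Rightarrow> real) \<Rightarrow> real" where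
  "n_count t g = (\<Sum>s | \<bar>s\<bar> \<le> t \<and> trop_pole g s. \<bar>slope_jump g s\<bar>)"

definition N_count :: "real \<Rightarrow> (real \<Rightarrow> real) \<Rightarrow> real" where
  "N_count r g = 1 / 2 * integral {0..r} (\<lambda>t. n_count t g)"

definition reduced_rep :: "nat \<Rightarrow> (nat \<Rightarrow> real \<Rightarrow> real) \<Rightarrow> bool" where
  "reduced_rep n f \<longleftrightarrow> (\<forall>i\<le>n. trop_entire (f i)) \<and> (\<nexists>x. \<forall>i\<le>n. trop_root (f i) x)"

definition trop_curve :: "nat \<Rightarrow> (nat \<Rightarrow> real \<Rightarrow> real) \<Rightarrow> real \<Rightarrow> (nat \<Rightarrow> ereal) set" where
  "trop_curve n f x = proj_point n (\<lambda>i. ereal (f i x))"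

definition linearly_nondegenerate :: "nat \<Rightarrow> (real \<Rightarrow> (nat \<Rightarrow> ereal) set) \<Rightarrow> bool" where
  "linearly_nondegenerate n F \<longleftrightarrow> (\<forall>a \<in> trop_vec n. \<not> range F \<subseteq> trop_hyperplane n a)"

definition curve_norm :: "nat \<Rightarrow> (nat \<Rightarrow> real \<Rightarrow> real) \<Rightarrow> real \<Rightarrow> real" where
  "curve_norm n f x = (MAX i\<in>{..n}. f i x)"

definition T_char :: "nat \<Rightarrow> (nat \<Rightarrow> real \<Rightarrow> real) \<Rightarrow> real \<Rightarrow> real" where
  "T_char n f r = 1 / 2 * (curve_norm n f r + curve_norm n f (- r)) - curve_norm n f 0"

(* For a in trop_vec n the maximum is finite, so real_of_ereal loses nothing. *)

definition comp_curve :: "nat \<Rightarrow> (nat \<Rightarrow> ereal) \<Rightarrow> (nat \<Rightarrow> real \<Rightarrow> real) \<Rightarrow> real \<Rightarrow> real" where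
  "comp_curve n a f x = real_of_ereal (trop_linear n a (\<lambda>i. ereal (f i x)))"

end

theory Submission
  imports Defs
begin

text \<open>
  Everything reduces to an inequality between values at a single point. The tropical Jensen formula
  turns the root count \<open>N(r, -g)\<close> of an entire function \<open>g\<close> into
  \<open>(g r + g (- r)) / 2 - g 0\<close>, and \<open>T_char\<close> has the same shape in terms of
  \<open>curve_norm\<close>. Hence the estimate holds as soon as
  \<open>\<Sum>\<^sub>j P\<^sub>j(f(x)) - \<Sum>\<^sub>i f\<^sub>i(x) - (q - n - 1) max\<^sub>i f\<^sub>i(x)\<close>
  is bounded below uniformly in \<open>x\<close>: average this bound over \<open>x = r\<close> and
  \<open>x = -r\<close>; the value at \<open>0\<close> is part of the constant.

  For the lower bound, \<open>P\<^sub>j(f(x)) \<ge> f\<^sub>i(x) - const\<close> whenever the coefficient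
  \<open>a j i\<close> is finite. General position implies that any \<open>n + 1\<close> of the hyperplanes
  can be matched bijectively with the coordinates through finite coefficients
  (\<open>general_position_matching\<close>). Fix \<open>x\<close> and let \<open>m\<close> be an index for which
  \<open>f\<^sub>m(x)\<close> is maximal. By the matching property at most \<open>n\<close> hyperplanes have
  \<open>a j m = -\<infinity>\<close>. Put these into a set \<open>S\<close> of \<open>n + 1\<close> hyperplanes: the
  matching of \<open>S\<close> contributes \<open>\<Sum>\<^sub>i f\<^sub>i(x)\<close>, and each of the remaining
  \<open>q - n - 1\<close> hyperplanes contributes \<open>f\<^sub>m(x)\<close>. For \<open>q = 1\<close> a single finite
  coefficient suffices (\<open>pointwise_bound_single\<close>).

  The matching property is a tropical form of the fact that a singular matrix has a nonzero kernel
  vector. If there is no matching, a suitable vector of maximal weights of partial matchings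
  (tropical Cramer's rule) represents a point on all hyperplanes in question
  (\<open>tropical_kernel_if_no_matching\<close>).
\<close>

section \<open>One-sided slopes\<close>

text \<open>
  A convex piecewise linear function is described locally: at every point it has linear germs on
  both sides, and the slope does not decrease. Such germs can be added and compared pointwise, so no
  set of breakpoints has to be tracked when maxima are taken.
\<close>

definition slopes_at :: "(real \<Rightarrow> real) \<Rightarrow> real \<Rightarrow> real \<Rightarrow> real \<Rightarrow> bool" where
  "slopes_at g x l r \<longleftrightarrow>
     (\<forall>\<^sub>F y in at_left x. g y = g x + l * (y - x)) \<and>
     (\<forall>\<^sub>F y in at_right x. g y = g x + r * (y - x))"

definition slope_convex :: "(real \<Rightarrow> real) \<Rightarrow> bool" where
  "slope_convex g \<longleftrightarrow> (\<forall>x. \<exists>l r. l \<le> r \<and> slopes_at g x l r)"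

lemma slope_convexE:
  assumes "slope_convex g"
  obtains l r where "l \<le> r" "slopes_at g x l r"
  using assms unfolding slope_convex_def by meson

lemma slopes_at_ball:
  assumes "slopes_at g x l r"
  obtains e where "e > 0"
    and "\<And>y. x - e < y \<Longrightarrow> y < x \<Longrightarrow> g y = g x + l * (y - x)"
    and "\<And>y. x < y \<Longrightarrow> y < x + e \<Longrightarrow> g y = g x + r * (y - x)"
proof -
  from assms obtain b where b: "b < x" "\<forall>y>b. y < x \<longrightarrow> g y = g x + l * (y - x)"
    by (auto simp: slopes_at_def eventually_at_left_field)
  from assms obtain c where c: "c > x" "\<forall>y>x. y < c \<longrightarrow> g y = g x + r * (y - x)"
    by (auto simp: slopes_at_def eventually_at_right_field)
  show thesis
    by (rule that[of "min (x - b) (c - x)"]) (use b c in auto)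
qed

lemma slopes_at_isCont:
  assumes "slopes_at g x l r"
  shows "isCont g x"
proof -
  have "((\<lambda>y. g x + l * (y - x)) \<longlongrightarrow> g x) (at_left x)"
       "((\<lambda>y. g x + r * (y - x)) \<longlongrightarrow> g x) (at_right x)"
    by (auto intro!: tendsto_eq_intros)
  then have "(g \<longlongrightarrow> g x) (at_left x)" "(g \<longlongrightarrow> g x) (at_right x)"
    using assms unfolding slopes_at_def
    by (auto elim!: Lim_transform_eventually elim: eventually_mono)
  then show ?thesis
    by (simp add: isCont_def filterlim_split_at_real)
qed

lemma slopes_at_add:
  "slopes_at g x l r \<Longrightarrow> slopes_at h x l' r' \<Longrightarrow> slopes_at (\<lambda>y. g y + h y) x (l + l') (r + r')"
  unfolding slopes_at_def
  by (auto simp: algebra_simps elim: eventually_elim2)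

lemma slopes_at_cmult:
  "slopes_at g x l r \<Longrightarrow> slopes_at (\<lambda>y. c * g y) x (c * l) (c * r)"
  unfolding slopes_at_def
  by (auto simp: distrib_left mult.assoc elim!: eventually_mono)

lemma slopes_at_const: "slopes_at (\<lambda>y. c) x 0 0"
  by (simp add: slopes_at_def)

lemma slopes_at_sum:
  assumes "finite S" and "\<And>s. s \<in> S \<Longrightarrow> slopes_at (g s) x (l s) (r s)"
  shows "slopes_at (\<lambda>y. \<Sum>s\<in>S. g s y) x (\<Sum>s\<in>S. l s) (\<Sum>s\<in>S. r s)"
  using assms by (induction S rule: finite_induct) (auto intro: slopes_at_add slopes_at_const)

text \<open>
  The slope of \<open>max 0 (y - s)\<close> jumps by \<open>1\<close> at \<open>s\<close> and nowhere else; these functions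
  are the building blocks of the Jensen formula.
\<close>

lemma slopes_at_hinge:
  "slopes_at (\<lambda>y. max 0 (y - s)) x (if s < x then 1 else 0) (if s \<le> x then 1 else 0)"
proof -
  have "\<forall>\<^sub>F y in at_left x. max 0 (y - s) = max 0 (x - s) + (if s < x then 1 else 0) * (y - x)"
    unfolding eventually_at_left_field
    by (rule exI[of _ "if s < x then s else x - 1"]) auto
  moreover
  have "\<forall>\<^sub>F y in at_right x. max 0 (y - s) = max 0 (x - s) + (if s \<le> x then 1 else 0) * (y - x)"
    unfolding eventually_at_right_field
    by (rule exI[of _ "if s \<le> x then x + 1 else s"]) auto
  ultimately show ?thesis by (simp add: slopes_at_def)
qed

lemma slopes_at_max_dominant:
  assumes g: "slopes_at g x l r" and h: "isCont h x" and less: "h x < g x"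
  shows "slopes_at (\<lambda>y. max (g y) (h y)) x l r"
proof -
  have "((\<lambda>y. g y - h y) \<longlongrightarrow> g x - h x) (at x)"
    using slopes_at_isCont[OF g] h by (auto simp: isCont_def intro: tendsto_diff)
  then have "\<forall>\<^sub>F y in at x. 0 < g y - h y"
    by (rule order_tendstoD) (use less in simp)
  then have ev: "\<forall>\<^sub>F y in at_left x. h y < g y" "\<forall>\<^sub>F y in at_right x. h y < g y"
    by (simp_all add: eventually_at_split)
  have "\<forall>\<^sub>F y in at_left x. g y = g x + l * (y - x)" "\<forall>\<^sub>F y in at_right x. g y = g x + r * (y - x)"
    using g by (auto simp: slopes_at_def)
  with ev have "\<forall>\<^sub>F y in at_left x. max (g y) (h y) = g x + l * (y - x)"
    "\<forall>\<^sub>F y in at_right x. max (g y) (h y) = g x + r * (y - x)"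
    by (auto elim: eventually_elim2 simp: max_def)
  then show ?thesis using less by (simp add: slopes_at_def max_absorb1)
qed

text \<open>
  Where \<open>g\<close> and \<open>h\<close> differ, continuity lets the larger one dominate nearby. Where they agree,
  the maximum has left slope \<open>min l l'\<close> and right slope \<open>max r r'\<close>, so it still has no
  pole.
\<close>

lemma slope_convex_max:
  assumes "slope_convex g" and "slope_convex h"
  shows "slope_convex (\<lambda>y. max (g y) (h y))"
  unfolding slope_convex_def
proof
  fix x
  obtain l r where g: "l \<le> r" "slopes_at g x l r" by (rule slope_convexE[OF assms(1)])
  obtain l' r' where h: "l' \<le> r'" "slopes_at h x l' r'" by (rule slope_convexE[OF assms(2)])
  consider "h x < g x" | "g x < h x" | "g x = h x" by linarith
  then show "\<exists>l r. l \<le> r \<and> slopes_at (\<lambda>y. max (g y) (h y)) x l r"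
  proof cases
    case 1
    then show ?thesis using slopes_at_max_dominant[OF g(2) slopes_at_isCont[OF h(2)]] g(1) by blast
  next
    case 2
    then show ?thesis
      using slopes_at_max_dominant[OF h(2) slopes_at_isCont[OF g(2)]] h(1)
      unfolding max.commute[of "g _"] by blast
  next
    case 3
    \<comment> \<open>To the left of \<open>x\<close> the factor \<open>y - x\<close> is negative, so the smaller slope wins.\<close>
    have "\<forall>\<^sub>F y in at_left x. max (g y) (h y) = max (g x) (h x) + min l l' * (y - x)"
    proof -
      have "\<forall>\<^sub>F y in at_left x. y < x" by (simp add: eventually_at_filter)
      moreover have "\<forall>\<^sub>F y in at_left x. g y = g x + l * (y - x)"
        "\<forall>\<^sub>F y in at_left x. h y = h x + l' * (y - x)"
        using g h by (auto simp: slopes_at_def)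
      ultimately show ?thesis
      proof eventually_elim
        case (elim y)
        have "max (l * (y - x)) (l' * (y - x)) = min l l' * (y - x)"
          using elim by (auto simp: max_def min_def mult_le_cancel_right)
        then show ?case using 3 elim by (auto simp: max_def)
      qed
    qed
    moreover have "\<forall>\<^sub>F y in at_right x. max (g y) (h y) = max (g x) (h x) + max r r' * (y - x)"
    proof -
      have "\<forall>\<^sub>F y in at_right x. y > x" by (simp add: eventually_at_filter)
      moreover have "\<forall>\<^sub>F y in at_right x. g y = g x + r * (y - x)"
        "\<forall>\<^sub>F y in at_right x. h y = h x + r' * (y - x)"
        using g h by (auto simp: slopes_at_def)
      ultimately show ?thesis
      proof eventually_elim
        case (elim y)
        have "max (r * (y - x)) (r' * (y - x)) = max r r' * (y - x)"
          using elim by (auto simp: max_def mult_le_cancel_right)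
        then show ?case using 3 elim by (auto simp: max_def)
      qed
    qed
    ultimately have "slopes_at (\<lambda>y. max (g y) (h y)) x (min l l') (max r r')"
      by (simp add: slopes_at_def)
    moreover have "min l l' \<le> max r r'" using g(1) h(1) by linarith
    ultimately show ?thesis by blast
  qed
qed

lemma slope_convex_Max:
  assumes "finite I" and "I \<noteq> {}" and "\<And>i. i \<in> I \<Longrightarrow> slope_convex (g i)"
  shows "slope_convex (\<lambda>y. MAX i\<in>I. g i y)"
  using assms
proof (induction I rule: finite_ne_induct)
  case (singleton i)
  have "slope_convex (g i)" by (rule singleton) simp
  then show ?case by simp
next
  case (insert i I)
  then have "slope_convex (\<lambda>y. max (g i y) (MAX i\<in>I. g i y))"
    by (intro slope_convex_max) simp_all
  then show ?case using insert.hyps by simp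
qed

lemma slope_convex_add_const:
  assumes "slope_convex g"
  shows "slope_convex (\<lambda>y. c + g y)"
  unfolding slope_convex_def
proof
  fix x
  obtain l r where lr: "l \<le> r" "slopes_at g x l r" by (rule slope_convexE[OF assms])
  have "slopes_at (\<lambda>y. c + g y) x l r"
    using slopes_at_add[OF slopes_at_const lr(2), of c] by simp
  with lr(1) show "\<exists>l r. l \<le> r \<and> slopes_at (\<lambda>y. c + g y) x l r" by blast
qed

lemma slopes_at_deriv:
  assumes "e > 0"
    and left: "\<And>y. x - e < y \<Longrightarrow> y < x \<Longrightarrow> g y = g x + l * (y - x)"
    and right: "\<And>y. x < y \<Longrightarrow> y < x + e \<Longrightarrow> g y = g x + r * (y - x)"
  shows "\<And>y. x - e < y \<Longrightarrow> y < x \<Longrightarrow> (g has_real_derivative l) (at y)"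
    and "\<And>y. x < y \<Longrightarrow> y < x + e \<Longrightarrow> (g has_real_derivative r) (at y)"
proof -
  fix y assume "x - e < y" "y < x"
  moreover have "((\<lambda>y. g x + l * (y - x)) has_real_derivative l) (at y)"
    by (auto intro!: derivative_eq_intros)
  ultimately show "(g has_real_derivative l) (at y)"
    by (elim has_field_derivative_transform_within_open[of _ _ _ "{x - e<..<x}"]) (auto simp: left)
next
  fix y assume "x < y" "y < x + e"
  moreover have "((\<lambda>y. g x + r * (y - x)) has_real_derivative r) (at y)"
    by (auto intro!: derivative_eq_intros)
  ultimately show "(g has_real_derivative r) (at y)"
    by (elim has_field_derivative_transform_within_open[of _ _ _ "{x<..<x + e}"]) (auto simp: right)
qed

lemma slope_jump_eq:
  assumes "slopes_at g x l r"
  shows "slope_jump g x = r - l"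
proof -
  obtain e where e: "e > 0"
    "\<And>y. x - e < y \<Longrightarrow> y < x \<Longrightarrow> g y = g x + l * (y - x)"
    "\<And>y. x < y \<Longrightarrow> y < x + e \<Longrightarrow> g y = g x + r * (y - x)"
    using slopes_at_ball[OF assms] by metis
  note D = slopes_at_deriv[OF e, THEN DERIV_imp_deriv]
  have "\<forall>\<^sub>F d in at_right 0. deriv g (x + d) - deriv g (x - d) = r - l"
    unfolding eventually_at_right_field
    by (rule exI[of _ e]) (use e(1) in \<open>auto simp: D\<close>)
  then have "((\<lambda>d. deriv g (x + d) - deriv g (x - d)) \<longlongrightarrow> r - l) (at_right 0)"
    by (rule tendsto_eventually)
  then show ?thesis unfolding slope_jump_def by (intro tendsto_Lim) auto
qed

text \<open>
  Local finiteness of the breakpoints leaves an interval on either side of \<open>x\<close> on which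
  \<open>g\<close> is affine; continuity makes both affine functions pass through \<open>(x, g x)\<close>.
\<close>

lemma trop_meromorphic_slopes_at:
  assumes "trop_meromorphic g"
  obtains l r where "slopes_at g x l r"
proof -
  have cont: "isCont g x"
    using assms by (auto simp: trop_meromorphic_def continuous_on_eq_continuous_at)
  obtain B where B: "\<And>r. finite (B \<inter> {-r..r})"
    "\<And>a b. {a<..<b} \<inter> B = {} \<Longrightarrow> \<exists>m c. \<forall>x\<in>{a<..<b}. g x = m * x + c"
    using assms by (auto simp: trop_meromorphic_def)
  define R where "R = \<bar>x\<bar> + 1"
  obtain d where d: "d > 0" "\<And>y. y \<in> B \<inter> {-R..R} \<Longrightarrow> y \<noteq> x \<Longrightarrow> d \<le> dist x y"
    using finite_set_avoid[OF B(1)[of R], of x] by metis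
  define e where "e = min d 1"
  have e: "e > 0" "e \<le> 1" "e \<le> d" using d by (auto simp: e_def)
  have avoid: "y \<notin> B" if "y \<noteq> x" "\<bar>y - x\<bar> < e" for y
  proof
    assume "y \<in> B"
    moreover have "y \<in> {-R..R}" using that(2) e(2) unfolding R_def by auto
    ultimately have "d \<le> dist x y" using d(2) that(1) by blast
    then show False using that(2) e(3) by (simp add: dist_real_def abs_minus_commute)
  qed
  have "{x - e<..<x} \<inter> B = {}" "{x<..<x + e} \<inter> B = {}"
    using avoid by fastforce+
  then obtain l c r c' where
    lin: "\<And>y. y \<in> {x - e<..<x} \<Longrightarrow> g y = l * y + c"
    "\<And>y. y \<in> {x<..<x + e} \<Longrightarrow> g y = r * y + c'"
    using B(2) by meson
  have ev: "\<forall>\<^sub>F y in at_left x. g y = l * y + c" "\<forall>\<^sub>F y in at_right x. g y = r * y + c'"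
    using lin e eventually_at_left_real[of "x - e" x] eventually_at_right_real[of x "x + e"]
    by (auto elim!: eventually_mono)
  have "(g \<longlongrightarrow> g x) (at_left x)" "(g \<longlongrightarrow> g x) (at_right x)"
    using cont by (auto simp: isCont_def intro: tendsto_within_subset)
  then have "((\<lambda>y. l * y + c) \<longlongrightarrow> g x) (at_left x)" "((\<lambda>y. r * y + c') \<longlongrightarrow> g x) (at_right x)"
    using ev by (auto elim: Lim_transform_eventually)
  moreover have "((\<lambda>y. l * y + c) \<longlongrightarrow> l * x + c) (at_left x)"
    "((\<lambda>y. r * y + c') \<longlongrightarrow> r * x + c') (at_right x)"
    by (auto intro!: tendsto_eq_intros)
  ultimately have gx: "g x = l * x + c" "g x = r * x + c'"
    using tendsto_unique trivial_limit_at_left_real trivial_limit_at_right_real by blast+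
  have "slopes_at g x l r"
    using ev unfolding slopes_at_def
    by (auto elim!: eventually_mono simp: gx(1) right_diff_distrib) (use gx in linarith)
  then show thesis by (rule that)
qed

lemma trop_entire_slope_convex:
  assumes "trop_entire g"
  shows "slope_convex g"
  unfolding slope_convex_def
proof
  fix x
  obtain l r where lr: "slopes_at g x l r"
    using trop_meromorphic_slopes_at assms unfolding trop_entire_def by metis
  moreover have "\<not> slope_jump g x < 0" using assms by (auto simp: trop_entire_def trop_pole_def)
  ultimately show "\<exists>l r. l \<le> r \<and> slopes_at g x l r"
    using slope_jump_eq[OF lr] by (intro exI[of _ l] exI[of _ r]) auto
qed


section \<open>The tropical Jensen formula\<close>

text \<open>
  Infinitely many jumps in a compact interval would accumulate at some point, but on either side
  of any point \<open>g\<close> is affine nearby.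
\<close>

lemma finite_slope_jumps:
  assumes "slope_convex g"
  shows "finite {x. \<bar>x\<bar> \<le> R \<and> slope_jump g x \<noteq> 0}"
proof (rule ccontr)
  let ?J = "{x. \<bar>x\<bar> \<le> R \<and> slope_jump g x \<noteq> 0}"
  assume inf: "infinite ?J"
  have sub: "?J \<subseteq> {-R..R}" by auto
  obtain x where x: "x islimpt ?J"
    using Heine_Borel_imp_Bolzano_Weierstrass[OF compact_Icc inf sub] by blast
  obtain l r where lr: "slopes_at g x l r" by (rule slope_convexE[OF assms])
  obtain e where e: "e > 0"
    "\<And>y. x - e < y \<Longrightarrow> y < x \<Longrightarrow> g y = g x + l * (y - x)"
    "\<And>y. x < y \<Longrightarrow> y < x + e \<Longrightarrow> g y = g x + r * (y - x)"
    using slopes_at_ball[OF lr] by metis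
  obtain y where y: "y \<in> ?J" "y \<noteq> x" "dist y x < e"
    using x e(1) by (auto simp: islimpt_approachable)
  have "slopes_at g y l l" if "y < x"
  proof -
    have eq: "g z = g y + l * (z - y)" if "z \<in> {x - e<..<x}" for z
      using e(2)[of z] e(2)[of y] that y \<open>y < x\<close> by (simp add: dist_real_def algebra_simps)
    have "x - e < y" using y that by (simp add: dist_real_def)
    then show ?thesis
      unfolding slopes_at_def
      using eventually_at_left_real[of "x - e" y] eventually_at_right_real[of y x] that
      by (auto elim!: eventually_mono intro!: eq)
  qed
  moreover have "slopes_at g y r r" if "x < y"
  proof -
    have eq: "g z = g y + r * (z - y)" if "z \<in> {x<..<x + e}" for z
      using e(3)[of z] e(3)[of y] that y \<open>x < y\<close> by (simp add: dist_real_def algebra_simps)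
    have "y < x + e" using y that by (simp add: dist_real_def)
    then show ?thesis
      unfolding slopes_at_def
      using eventually_at_left_real[of x y] eventually_at_right_real[of y "x + e"] that
      by (auto elim!: eventually_mono intro!: eq)
  qed
  ultimately have "slope_jump g y = 0"
    using y(2) slope_jump_eq by (metis linorder_neqE diff_self)
  with y(1) show False by simp
qed

lemma affine_if_no_slope_jumps:
  assumes h: "\<And>x. x \<in> {a<..<b} \<Longrightarrow> \<exists>m. slopes_at h x m m"
  obtains m c where "\<And>x. x \<in> {a<..<b} \<Longrightarrow> h x = m * x + c"
proof (cases "a < b")
  case True
  have local: "\<exists>m. \<exists>e>0. \<forall>y. \<bar>y - x\<bar> < e \<longrightarrow> (h has_real_derivative m) (at y)" 
    if x: "x \<in> {a<..<b}" for x
  proof -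
    obtain m where m: "slopes_at h x m m" using h[OF x] by blast
    obtain e where e: "e > 0"
      "\<And>y. x - e < y \<Longrightarrow> y < x \<Longrightarrow> h y = h x + m * (y - x)"
      "\<And>y. x < y \<Longrightarrow> y < x + e \<Longrightarrow> h y = h x + m * (y - x)"
      using slopes_at_ball[OF m] by metis
    have eq: "h y = h x + m * (y - x)" if "y \<in> {x - e<..<x + e}" for y
      using e that by (cases y x rule: linorder_cases) auto
    have "(h has_real_derivative m) (at y)" if "\<bar>y - x\<bar> < e" for y
    proof -
      have "((\<lambda>y. h x + m * (y - x)) has_real_derivative m) (at y)"
        by (auto intro!: derivative_eq_intros)
      then show ?thesis
      proof (rule has_field_derivative_transform_within_open[of _ _ _ "{x - e<..<x + e}"])
        show "y \<in> {x - e<..<x + e}" using that by auto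
      qed (simp_all add: eq[symmetric])
    qed
    with e(1) show ?thesis by blast
  qed
  define D where "D = deriv h"
  have der: "(h has_real_derivative D x) (at x)" if x: "x \<in> {a<..<b}" for x
    using local[OF x] unfolding D_def by (metis DERIV_imp_deriv abs_zero diff_self)
  have "(D has_real_derivative 0) (at x)" if x: "x \<in> {a<..<b}" for x
  proof -
    obtain m e where e: "e > 0" "\<And>y. \<bar>y - x\<bar> < e \<Longrightarrow> (h has_real_derivative m) (at y)"
      using local[OF x] by blast
    have "((\<lambda>y. m) has_real_derivative 0) (at x)" by simp
    then show ?thesis
      by (rule has_field_derivative_transform_within_open[of _ _ _ "{x - e<..<x + e}"])
        (use e in \<open>auto simp: D_def abs_less_iff intro!: DERIV_imp_deriv[symmetric]\<close>)
  qed
  then have const: "D x = D y" if "x \<in> {a<..<b}" "y \<in> {a<..<b}" for x y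
    using DERIV_isconst3[OF True that] by blast
  obtain z where z: "z \<in> {a<..<b}" using True dense by auto
  have "((\<lambda>x. h x - D z * x) has_real_derivative 0) (at x)" if x: "x \<in> {a<..<b}" for x
    using der[OF x] const[OF x z] by (auto intro!: derivative_eq_intros)
  then have "h x - D z * x = h z - D z * z" if "x \<in> {a<..<b}" for x
    using DERIV_isconst3[OF True that z, of "\<lambda>x. h x - D z * x"] by blast
  then show thesis by (intro that[of "D z" "h z - D z * z"]) (auto simp: algebra_simps)
qed (use that in auto)

text \<open>
  Subtracting one hinge for each slope jump cancels all jumps, and what remains is affine. This is
  the one-dimensional Riesz decomposition of a convex function with finitely many kinks.
\<close>

lemma hinge_decomposition:
  assumes g: "slope_convex g"
  obtains m c where "\<And>x. \<bar>x\<bar> < R \<Longrightarrow>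
    g x = m * x + c + (\<Sum>s | \<bar>s\<bar> \<le> R \<and> slope_jump g s \<noteq> 0. slope_jump g s * max 0 (x - s))"
proof -
  define S where "S = {s. \<bar>s\<bar> \<le> R \<and> slope_jump g s \<noteq> 0}"
  have fin: "finite S" unfolding S_def by (rule finite_slope_jumps[OF g])
  define h where "h = (\<lambda>x. g x + (-1) * (\<Sum>s\<in>S. slope_jump g s * max 0 (x - s)))"
  have "\<exists>m. slopes_at h x m m" if x: "x \<in> {-R<..<R}" for x
  proof -
    obtain l r where lr: "slopes_at g x l r" by (rule slope_convexE[OF g])
    have jump: "slope_jump g x = r - l" by (rule slope_jump_eq[OF lr])
    let ?A = "\<Sum>s\<in>S. slope_jump g s * (if s < x then 1 else 0)"
    let ?B = "\<Sum>s\<in>S. slope_jump g s * (if s \<le> x then 1 else 0)"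
    have "slopes_at h x (l + (-1) * ?A) (r + (-1) * ?B)"
      unfolding h_def
      by (intro slopes_at_add[OF lr] slopes_at_cmult slopes_at_sum[OF fin] slopes_at_hinge)
    moreover have "?B - ?A = (\<Sum>s\<in>S. if s = x then slope_jump g s else 0)"
      unfolding sum_subtractf[symmetric] by (rule sum.cong) auto
    moreover have "\<dots> = slope_jump g x"
      using x unfolding sum.delta[OF fin] by (auto simp: S_def)
    ultimately have "slopes_at h x (l + (-1) * ?A) (r + (-1) * ?B)"
      and "r + (-1) * ?B = l + (-1) * ?A"
      using jump by linarith+
    then show ?thesis by metis
  qed
  then obtain m c where "\<And>x. x \<in> {-R<..<R} \<Longrightarrow> h x = m * x + c"
    using affine_if_no_slope_jumps by metis
  then show thesis by (intro that[of m c]) (auto simp: h_def S_def[symmetric] abs_less_iff algebra_simps)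
qed

text \<open>
  By the hinge decomposition both sides are sums over the jumps. The affine part has vanishing
  second difference at \<open>-r, 0, r\<close>, and a hinge at \<open>s\<close> has second difference
  \<open>max 0 (r - \<bar>s\<bar>)\<close>, which is the length of the set of radii \<open>t \<in> [0, r]\<close> for
  which \<open>s\<close> is counted.
\<close>

theorem tropical_Jensen:
  assumes g: "slope_convex g" and r: "r \<ge> 0"
  shows "N_count r (\<lambda>x. - g x) = 1 / 2 * (g r + g (- r)) - g 0"
proof -
  \<comment> \<open>The decomposition is valid on an open interval only; it has to contain \<open>r\<close> and \<open>-r\<close>.\<close>
  define R where "R = r + 1"
  define J where "J = slope_jump g"
  define S where "S = {s. \<bar>s\<bar> \<le> R \<and> J s \<noteq> 0}"
  have fin: "finite S" unfolding S_def J_def by (rule finite_slope_jumps[OF g])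
  have pos: "J x \<ge> 0" for x
  proof -
    obtain l r where "l \<le> r" "slopes_at g x l r" by (rule slope_convexE[OF g])
    then show ?thesis using slope_jump_eq[of g x l r] by (simp add: J_def)
  qed
  have neg: "slope_jump (\<lambda>x. - g x) x = - J x" for x
  proof -
    obtain l r where lr: "slopes_at g x l r" by (rule slope_convexE[OF g])
    show ?thesis
      using slope_jump_eq[OF lr] slope_jump_eq[OF slopes_at_cmult[OF lr, of "-1"]] by (simp add: J_def)
  qed
  have count: "n_count t (\<lambda>x. - g x) = (\<Sum>s\<in>S. J s * (if \<bar>s\<bar> \<le> t then 1 else 0))"
    if t: "t \<in> {0..r}" for t
  proof -
    have "{s. \<bar>s\<bar> \<le> t \<and> trop_pole (\<lambda>x. - g x) s} = {s \<in> S. \<bar>s\<bar> \<le> t}"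
      using t pos by (auto simp: S_def R_def trop_pole_def neg order.not_eq_order_implies_strict)
    then have "n_count t (\<lambda>x. - g x) = (\<Sum>s\<in>{s \<in> S. \<bar>s\<bar> \<le> t}. J s)"
      unfolding n_count_def by (simp add: neg pos)
    also have "\<dots> = (\<Sum>s\<in>S. J s * (if \<bar>s\<bar> \<le> t then 1 else 0))"
      by (simp add: sum.inter_filter[OF fin] if_distrib cong: if_cong)
    finally show ?thesis .
  qed
  have step: "((\<lambda>t. if \<bar>s\<bar> \<le> t then 1 else 0) has_integral max 0 (r - \<bar>s\<bar>)) {0..r}" for s :: real
  proof -
    have "((\<lambda>t. 1) has_integral (if \<bar>s\<bar> \<le> r then r - \<bar>s\<bar> else 0)) {\<bar>s\<bar>..r}"
      using has_integral_const_real[of "1::real" "\<bar>s\<bar>" r] by auto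
    then have "((\<lambda>t. if t \<in> {\<bar>s\<bar>..r} then 1 else 0) has_integral max 0 (r - \<bar>s\<bar>)) {0..r}"
      by (subst has_integral_restrict) (auto simp: max_def split: if_splits)
    then show ?thesis by (rule has_integral_eq[rotated]) auto
  qed
  have "((\<lambda>t. \<Sum>s\<in>S. J s * (if \<bar>s\<bar> \<le> t then 1 else 0)) has_integral
      (\<Sum>s\<in>S. J s * max 0 (r - \<bar>s\<bar>))) {0..r}"
    by (intro has_integral_sum[OF fin] has_integral_mult_right step)
  then have "((\<lambda>t. n_count t (\<lambda>x. - g x)) has_integral (\<Sum>s\<in>S. J s * max 0 (r - \<bar>s\<bar>))) {0..r}"
    by (rule has_integral_eq[rotated]) (simp add: count)
  then have N: "N_count r (\<lambda>x. - g x) = 1 / 2 * (\<Sum>s\<in>S. J s * max 0 (r - \<bar>s\<bar>))"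
    by (simp add: N_count_def integral_unique)
  obtain m c where dec: "\<And>x. \<bar>x\<bar> < R \<Longrightarrow> g x = m * x + c + (\<Sum>s\<in>S. J s * max 0 (x - s))"
    by (rule hinge_decomposition[OF g, of R, folded J_def, folded S_def]) blast
  have "g r + g (- r) - 2 * g 0 =
      (\<Sum>s\<in>S. J s * max 0 (r - s) + J s * max 0 (- r - s) - 2 * (J s * max 0 (0 - s)))"
    using r dec[of r] dec[of "- r"] dec[of 0]
    by (simp add: R_def sum.distrib sum_subtractf sum_distrib_left)
  also have "\<dots> = (\<Sum>s\<in>S. J s * max 0 (r - \<bar>s\<bar>))"
  proof (rule sum.cong)
    fix s
    have "max 0 (r - s) + max 0 (- r - s) - 2 * max 0 (0 - s) = max 0 (r - \<bar>s\<bar>)"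
      using r by (auto simp: max_def abs_if)
    then have "J s * max 0 (r - \<bar>s\<bar>) = J s * (max 0 (r - s) + max 0 (- r - s) - 2 * max 0 (0 - s))"
      by simp
    then show "J s * max 0 (r - s) + J s * max 0 (- r - s) - 2 * (J s * max 0 (0 - s)) =
        J s * max 0 (r - \<bar>s\<bar>)"
      by (simp only: distrib_left right_diff_distrib mult.left_commute)
  qed simp
  finally show ?thesis using N by (simp add: field_simps)
qed


section \<open>Matchings and general position\<close>

text \<open>
  Read \<open>E r l\<close> as finiteness of the entry \<open>w r l\<close> of a tropical matrix with rows
  \<open>R\<close> and columns \<open>L\<close>. Among the column sets that cannot be matched into \<open>R\<close> take
  a minimal one, \<open>K\<close>, so that removing any column makes it matchable; let \<open>x l\<close> be the
  maximal weight of a matching of \<open>K - {l}\<close>. These are the minors of Cramer's rule. If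
  \<open>E r l\<close> holds and \<open>\<sigma>\<close> is an optimal matching of \<open>K - {l}\<close>, then \<open>\<sigma>\<close> must use
  the row \<open>r\<close>, say for the column \<open>k\<close>, as otherwise \<open>l \<mapsto> r\<close> would extend it to a
  matching of \<open>K\<close>. Reassigning \<open>r\<close> from \<open>k\<close> to \<open>l\<close> gives a matching of
  \<open>K - {k}\<close>, whence \<open>w r l + x l \<le> w r k + x k\<close>. Applied to a maximal term of row
  \<open>r\<close>, this says that the maximum is attained twice.
\<close>

lemma tropical_kernel_if_no_matching:
  fixes E :: "'r \<Rightarrow> 'c \<Rightarrow> bool" and w :: "'r \<Rightarrow> 'c \<Rightarrow> real"
  assumes "finite R" and "finite L"
    and "\<nexists>\<sigma>. inj_on \<sigma> L \<and> \<sigma> ` L \<subseteq> R \<and> (\<forall>l\<in>L. E (\<sigma> l) l)"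
  shows "\<exists>K x. K \<subseteq> L \<and> K \<noteq> {} \<and>
    (\<forall>r\<in>R. \<forall>l\<in>K. E r l \<longrightarrow> (\<exists>k\<in>K. k \<noteq> l \<and> E r k \<and> w r l + x l \<le> w r k + x k))"
proof -
  define match where "match K = {\<sigma> \<in> K \<rightarrow>\<^sub>E R. inj_on \<sigma> K \<and> (\<forall>l\<in>K. E (\<sigma> l) l)}" for K
  have "match L = {}"
    using assms(3) by (auto simp: match_def PiE_def Pi_def)
  then obtain K where K: "K \<subseteq> L" "match K = {}" and min: "\<And>K'. K' \<subset> K \<Longrightarrow> match K' \<noteq> {}"
  proof -
    let ?F = "{K. K \<subseteq> L \<and> match K = {}}"
    have "finite ?F" using assms(2) by simp
    moreover have "L \<in> ?F" using \<open>match L = {}\<close> by simp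
    ultimately obtain K where K: "K \<in> ?F" "\<forall>K'\<in>?F. \<not> K' \<subset> K"
      by (metis (no_types, lifting) finite_has_minimal2 psubsetE)
    show thesis
    proof (rule that)
      fix K'
      assume K': "K' \<subset> K"
      then have "K' \<subseteq> L" using K(1) by auto
      moreover have "K' \<notin> ?F" using K(2) K' by blast
      ultimately show "match K' \<noteq> {}" by simp
    qed (use K(1) in simp_all)
  qed
  have finK: "finite K" using K(1) assms(2) finite_subset by blast
  have "K \<noteq> {}" using K(2) by (auto simp: match_def)
  have finm: "finite (match K')" if "K' \<subseteq> K" for K'
  proof -
    have "finite (K' \<rightarrow>\<^sub>E R)" by (intro finite_PiE finite_subset[OF that finK] assms(1))
    then show ?thesis by (rule finite_subset[rotated]) (auto simp: match_def)
  qed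
  define wt where "wt K' \<sigma> = (\<Sum>l\<in>K'. w (\<sigma> l) l)" for K' \<sigma>
  define x where "x l = Max (wt (K - {l}) ` match (K - {l}))" for l
  have "\<exists>k\<in>K. k \<noteq> l \<and> E r k \<and> w r l + x l \<le> w r k + x k"
    if r: "r \<in> R" and l: "l \<in> K" and E: "E r l" for r l
  proof -
    have "match (K - {l}) \<noteq> {}" using min l by blast
    then have "x l \<in> wt (K - {l}) ` match (K - {l})"
      unfolding x_def by (intro Max_in finite_imageI finm) auto
    then obtain \<sigma> where \<sigma>: "\<sigma> \<in> match (K - {l})" "x l = wt (K - {l}) \<sigma>" by blast
    have inj: "inj_on \<sigma> (K - {l})" and E\<sigma>: "\<And>k. k \<in> K - {l} \<Longrightarrow> E (\<sigma> k) k"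
      and R\<sigma>: "\<And>k. k \<in> K - {l} \<Longrightarrow> \<sigma> k \<in> R"
      using \<sigma>(1) by (auto simp: match_def PiE_def Pi_def)
    have "r \<in> \<sigma> ` (K - {l})"
    proof (rule ccontr)
      assume "r \<notin> \<sigma> ` (K - {l})"
      then have "restrict (\<sigma>(l := r)) K \<in> match K"
        using inj E\<sigma> R\<sigma> r E by (auto simp: match_def inj_on_def image_iff)
      with K(2) show False by blast
    qed
    then obtain k where k: "k \<in> K" "k \<noteq> l" "\<sigma> k = r" by blast
    define \<tau> where "\<tau> = restrict (\<sigma>(l := r)) (K - {k})"
    have \<tau>: "\<tau> \<in> match (K - {k})"
      unfolding match_def
    proof (intro CollectI conjI)
      show "\<tau> \<in> K - {k} \<rightarrow>\<^sub>E R" using R\<sigma> r by (auto simp: \<tau>_def)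
      have "\<sigma> i \<noteq> r" if "i \<in> K - {k}" "i \<noteq> l" for i
        using inj_onD[OF inj, of i k] that k by auto
      then show "inj_on \<tau> (K - {k})"
        using inj_onD[OF inj] by (auto simp: \<tau>_def inj_on_def)
      show "\<forall>i\<in>K - {k}. E (\<tau> i) i" using E E\<sigma> by (auto simp: \<tau>_def)
    qed
    have "w r k + wt (K - {k}) \<tau> = w r l + wt (K - {l}) \<sigma>"
    proof -
      have "wt (K - {k}) \<tau> = w r l + (\<Sum>i\<in>K - {k} - {l}. w (\<sigma> i) i)"
        unfolding wt_def
        by (subst sum.remove[of _ l]) (use finK l k in \<open>auto simp: \<tau>_def intro!: sum.cong\<close>)
      moreover have "wt (K - {l}) \<sigma> = w r k + (\<Sum>i\<in>K - {l} - {k}. w (\<sigma> i) i)"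
        unfolding wt_def by (subst sum.remove[of _ k]) (use finK l k in auto)
      moreover have "K - {k} - {l} = K - {l} - {k}" by blast
      ultimately show ?thesis by simp
    qed
    moreover have "wt (K - {k}) \<tau> \<le> x k"
      unfolding x_def by (intro Max_ge finite_imageI finm imageI \<tau>) auto
    ultimately have "w r l + x l \<le> w r k + x k" using \<sigma>(2) by linarith
    moreover have "E r k" using E\<sigma> k by auto
    ultimately show ?thesis using k by blast
  qed
  then show ?thesis
    using K(1) \<open>K \<noteq> {}\<close> by (intro exI[of _ K] exI[of _ x]) blast
qed

lemma trop_linear_ge: "i \<le> n \<Longrightarrow> a i + x i \<le> trop_linear n a x"
  unfolding trop_linear_def by (intro Max_ge) auto

lemma trop_linear_attained:
  obtains i where "i \<le> n" "trop_linear n a x = a i + x i"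
proof -
  have "trop_linear n a x \<in> (\<lambda>i. a i + x i) ` {..n}"
    unfolding trop_linear_def by (intro Max_in) auto
  then show thesis using that by auto
qed

text \<open>
  A finite tropical kernel vector on the columns \<open>K\<close>, extended by \<open>-\<infinity>\<close>, is a point of
  projective space. It lies on every hyperplane of \<open>S\<close>: either a finite maximum is attained
  twice, or all of the at least two terms are \<open>-\<infinity>\<close>.
\<close>

lemma general_position_matching:
  assumes n: "n \<ge> 1"
    and a: "\<And>j. j \<in> {1..q} \<Longrightarrow> a j \<in> trop_vec n"
    and gp: "general_position n q (\<lambda>j. trop_hyperplane n (a j))"
    and S: "S \<subseteq> {1..q}" "card S = n + 1"
  shows "\<exists>\<sigma>. bij_betw \<sigma> {0..n} S \<and> (\<forall>i\<le>n. a (\<sigma> i) i \<noteq> -\<infinity>)"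
proof (rule ccontr)
  assume no: "\<nexists>\<sigma>. bij_betw \<sigma> {0..n} S \<and> (\<forall>i\<le>n. a (\<sigma> i) i \<noteq> -\<infinity>)"
  have finS: "finite S" using S(1) finite_subset by blast
  have nomatch: "\<nexists>\<sigma>. inj_on \<sigma> {0..n} \<and> \<sigma> ` {0..n} \<subseteq> S \<and> (\<forall>i\<in>{0..n}. a (\<sigma> i) i \<noteq> -\<infinity>)"
  proof
    assume "\<exists>\<sigma>. inj_on \<sigma> {0..n} \<and> \<sigma> ` {0..n} \<subseteq> S \<and> (\<forall>i\<in>{0..n}. a (\<sigma> i) i \<noteq> -\<infinity>)"
    then obtain \<sigma> where \<sigma>: "inj_on \<sigma> {0..n}" "\<sigma> ` {0..n} \<subseteq> S" "\<forall>i\<in>{0..n}. a (\<sigma> i) i \<noteq> -\<infinity>"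
      by blast
    then have "\<sigma> ` {0..n} = S"
      using S(2) by (intro card_subset_eq[OF finS]) (auto simp: card_image)
    then have "bij_betw \<sigma> {0..n} S \<and> (\<forall>i\<le>n. a (\<sigma> i) i \<noteq> -\<infinity>)"
      using \<sigma>(1,3) by (simp add: bij_betw_def)
    with no show False by blast
  qed
  obtain K x where K: "K \<subseteq> {0..n}" "K \<noteq> {}"
    and twice: "\<forall>j\<in>S. \<forall>i\<in>K. a j i \<noteq> -\<infinity> \<longrightarrow>
      (\<exists>k\<in>K. k \<noteq> i \<and> a j k \<noteq> -\<infinity> \<and> real_of_ereal (a j i) + x i \<le> real_of_ereal (a j k) + x k)"
    using tropical_kernel_if_no_matching[OF finS finite_atLeastAtMost nomatch,
        where w = "\<lambda>j i. real_of_ereal (a j i)"]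
    by (elim exE conjE) (rule that)
  define X where "X i = (if i \<in> K then ereal (x i) else -\<infinity>)" for i
  have X: "X \<in> trop_vec n"
    using K by (auto simp: trop_vec_def X_def subset_iff)
  have on: "attained_twice n (a j) X" if j: "j \<in> S" for j
  proof -
    have fin: "a j i \<noteq> \<infinity>" if "i \<le> n" for i
      using a[of j] S j that by (auto simp: trop_vec_def)
    have val: "a j i + X i = ereal (real_of_ereal (a j i) + x i)" if "i \<in> K" "a j i \<noteq> -\<infinity>" for i
      using that fin[of i] K by (cases "a j i") (auto simp: X_def)
    obtain i where i: "i \<le> n" "trop_linear n (a j) X = a j i + X i"
      by (rule trop_linear_attained)
    show ?thesis
    proof (cases "trop_linear n (a j) X = -\<infinity>")
      case True
      \<comment> \<open>All terms are \<open>-\<infinity>\<close>; two different indices exist because \<open>n \<ge> 1\<close>.\<close>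
      then have "a j k + X k = trop_linear n (a j) X" if "k \<le> n" for k
        using trop_linear_ge[OF that, of "a j" X] by simp
      then show ?thesis
        unfolding attained_twice_def using n by (intro exI[of _ 0] conjI exI[of _ 1]) auto
    next
      case False
      then have "i \<in> K" "a j i \<noteq> -\<infinity>"
        using i fin[of i] by (auto simp: X_def split: if_splits)
      moreover from this obtain k where k: "k \<in> K" "k \<noteq> i" "a j k \<noteq> -\<infinity>"
        "real_of_ereal (a j i) + x i \<le> real_of_ereal (a j k) + x k"
        using twice j by blast
      ultimately have "a j i + X i \<le> a j k + X k" by (simp add: val)
      moreover have "k \<le> n" using k K by auto
      ultimately have "a j k + X k = trop_linear n (a j) X"
        using trop_linear_ge[of k n "a j" X] i by simp
      then show ?thesis
        unfolding attained_twice_def using i k \<open>k \<le> n\<close> by metis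
    qed
  qed
  have "proj_point n X \<in> trop_proj n"
    using X by (simp add: trop_proj_def proj_point_def quotientI)
  then have mem: "proj_point n X \<in> trop_hyperplane n (a j)" if "j \<in> S" for j
    using X on[OF that] unfolding trop_hyperplane_def by blast
  obtain \<mu> where \<mu>: "bij_betw \<mu> {0..n} S"
    using finite_same_card_bij[of "{0..n}" S] finS S(2) by auto
  have "\<mu> i \<in> S" if "i \<in> {0..n}" for i
    using \<mu> that by (rule bij_betw_apply)
  then have "proj_point n X \<in> (\<Inter>i\<in>{0..n}. trop_hyperplane n (a (\<mu> i)))"
    using mem by blast
  moreover have "inj_on \<mu> {0..n} \<and> \<mu> ` {0..n} \<subseteq> {1..q}"
    using \<mu> S(1) by (simp add: bij_betw_def)
  ultimately show False using gp unfolding general_position_def by blast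
qed


section \<open>The pointwise inequality\<close>

lemma comp_curve_eq:
  assumes "a \<in> trop_vec n"
  shows "comp_curve n a f x = (MAX i\<in>{i. i \<le> n \<and> a i \<noteq> -\<infinity>}. real_of_ereal (a i) + f i x)"
proof -
  let ?I = "{i. i \<le> n \<and> a i \<noteq> -\<infinity>}"
  let ?v = "\<lambda>i. real_of_ereal (a i) + f i x"
  have ne: "?I \<noteq> {}" using assms by (auto simp: trop_vec_def)
  have val: "a i + ereal (f i x) = ereal (?v i)" if "i \<in> ?I" for i
    using that assms by (cases "a i") (auto simp: trop_vec_def)
  have "trop_linear n a (\<lambda>i. ereal (f i x)) = ereal (Max (?v ` ?I))"
  proof (rule antisym)
    obtain i where i: "i \<le> n" "trop_linear n a (\<lambda>i. ereal (f i x)) = a i + ereal (f i x)"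
      by (rule trop_linear_attained)
    show "trop_linear n a (\<lambda>i. ereal (f i x)) \<le> ereal (Max (?v ` ?I))"
    proof (cases "a i = -\<infinity>")
      case False
      then have "?v i \<le> Max (?v ` ?I)" using i by (intro Max_ge) auto
      then show ?thesis using i False val[of i] by simp
    qed (use i in simp)
    have "Max (?v ` ?I) \<in> ?v ` ?I" using ne by (intro Max_in) auto
    then obtain k where k: "k \<in> ?I" "Max (?v ` ?I) = ?v k" by blast
    then show "ereal (Max (?v ` ?I)) \<le> trop_linear n a (\<lambda>i. ereal (f i x))"
      using trop_linear_ge[of k n a "\<lambda>i. ereal (f i x)"] val[OF k(1)] by simp
  qed
  then show ?thesis by (simp add: comp_curve_def)
qed

lemma slope_convex_comp_curve:
  assumes "a \<in> trop_vec n" and "\<And>i. i \<le> n \<Longrightarrow> slope_convex (f i)"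
  shows "slope_convex (comp_curve n a f)"
proof -
  have "slope_convex (\<lambda>x. MAX i\<in>{i. i \<le> n \<and> a i \<noteq> -\<infinity>}. real_of_ereal (a i) + f i x)"
    using assms by (intro slope_convex_Max slope_convex_add_const) (auto simp: trop_vec_def)
  then show ?thesis by (simp add: comp_curve_eq[OF assms(1), abs_def])
qed

lemma comp_curve_ge:
  assumes "a \<in> trop_vec n" and "i \<le> n" and "a i \<noteq> -\<infinity>"
  shows "f i x - (\<Sum>k\<le>n. \<bar>real_of_ereal (a k)\<bar>) \<le> comp_curve n a f x"
proof -
  have "\<bar>real_of_ereal (a i)\<bar> \<le> (\<Sum>k\<le>n. \<bar>real_of_ereal (a k)\<bar>)"
    using assms(2) by (intro member_le_sum abs_ge_zero) simp_all
  moreover have "real_of_ereal (a i) + f i x \<le> comp_curve n a f x"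
    unfolding comp_curve_eq[OF assms(1)] using assms by (intro Max_ge) auto
  ultimately show ?thesis by linarith
qed

lemma curve_norm_ge: "i \<le> n \<Longrightarrow> f i x \<le> curve_norm n f x"
  unfolding curve_norm_def by (intro Max_ge) auto

lemma curve_norm_attained:
  obtains i where "i \<le> n" "curve_norm n f x = f i x"
proof -
  have "curve_norm n f x \<in> (\<lambda>i. f i x) ` {..n}"
    unfolding curve_norm_def by (intro Max_in) auto
  then show thesis using that by auto
qed

text \<open>
  One of the summands \<open>f i x\<close> is controlled by the hyperplane, at an index with finite
  coefficient; the other \<open>n\<close> are at most the norm.
\<close>

lemma pointwise_bound_single:
  assumes a: "a \<in> trop_vec n"
  shows "(\<Sum>i=0..n. f i x) - real n * curve_norm n f x
    \<le> comp_curve n a f x + (\<Sum>k\<le>n. \<bar>real_of_ereal (a k)\<bar>)"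
proof -
  obtain i where i: "i \<le> n" "a i \<noteq> -\<infinity>" using a by (auto simp: trop_vec_def)
  have "(\<Sum>k=0..n. f k x) = f i x + (\<Sum>k\<in>{0..n} - {i}. f k x)"
    using i by (intro sum.remove) auto
  also have "(\<Sum>k\<in>{0..n} - {i}. f k x) \<le> (\<Sum>k\<in>{0..n} - {i}. curve_norm n f x)"
    by (intro sum_mono curve_norm_ge) auto
  also have "\<dots> = real n * curve_norm n f x" using i by simp
  finally show ?thesis using comp_curve_ge[OF a i, of f x] by linarith
qed

text \<open>
  The set \<open>S\<close> of matched hyperplanes depends on \<open>x\<close> through the dominating coordinate, whereas
  the error term bounds all finite coefficients at once and does not.
\<close>

lemma pointwise_bound:
  assumes n: "n \<ge> 1" and q: "q \<ge> n + 1"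
    and a: "\<And>j. j \<in> {1..q} \<Longrightarrow> a j \<in> trop_vec n"
    and gp: "general_position n q (\<lambda>j. trop_hyperplane n (a j))"
  shows "(\<Sum>i=0..n. f i x) + (real q - real n - 1) * curve_norm n f x
    \<le> (\<Sum>j=1..q. comp_curve n (a j) f x) + (\<Sum>j=1..q. \<Sum>k\<le>n. \<bar>real_of_ereal (a j k)\<bar>)"
proof -
  define P where "P j = comp_curve n (a j) f x + (\<Sum>k\<le>n. \<bar>real_of_ereal (a j k)\<bar>)" for j
  have P: "f i x \<le> P j" if "j \<in> {1..q}" "i \<le> n" "a j i \<noteq> -\<infinity>" for i j
    using comp_curve_ge[OF a[OF that(1)] that(2,3), of f x] by (simp add: P_def)
  obtain m where m: "m \<le> n" "curve_norm n f x = f m x" by (rule curve_norm_attained)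
  define Z where "Z = {j \<in> {1..q}. a j m = -\<infinity>}"
  \<comment> \<open>A matching of \<open>n + 1\<close> elements of \<open>Z\<close> would pair the column \<open>m\<close> with a finite entry.\<close>
  have "card Z \<le> n"
  proof (rule ccontr)
    assume "\<not> card Z \<le> n"
    then have "n + 1 \<le> card Z" by simp
    then obtain S where S: "S \<subseteq> Z" "card S = n + 1"
      by (rule obtain_subset_with_card_n)
    moreover from this have "S \<subseteq> {1..q}" by (auto simp: Z_def)
    ultimately obtain \<sigma> where "bij_betw \<sigma> {0..n} S" "\<forall>i\<le>n. a (\<sigma> i) i \<noteq> -\<infinity>"
      using general_position_matching[OF n a gp, of S] by blast
    moreover from this(1) have "\<sigma> m \<in> Z" using S m by (auto simp: bij_betw_def)
    ultimately show False using m by (auto simp: Z_def)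
  qed
  moreover have "Z \<subseteq> {1..q}" by (auto simp: Z_def)
  ultimately obtain S where S: "Z \<subseteq> S" "S \<subseteq> {1..q}" "card S = n + 1"
    using exists_subset_between[of Z "n + 1" "{1..q}"] q by auto
  obtain \<sigma> where \<sigma>: "bij_betw \<sigma> {0..n} S" "\<forall>i\<le>n. a (\<sigma> i) i \<noteq> -\<infinity>"
    using general_position_matching[OF n a gp S(2,3)] by auto
  have "\<sigma> i \<in> {1..q}" if "i \<in> {0..n}" for i
    using bij_betw_apply[OF \<sigma>(1) that] S(2) by blast
  then have "(\<Sum>i=0..n. f i x) \<le> (\<Sum>i=0..n. P (\<sigma> i))"
    using \<sigma>(2) by (intro sum_mono P) simp_all
  also have "\<dots> = (\<Sum>j\<in>S. P j)" by (rule sum.reindex_bij_betw[OF \<sigma>(1)])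
  finally have inside: "(\<Sum>i=0..n. f i x) \<le> (\<Sum>j\<in>S. P j)" .
  have "card ({1..q} - S) = q - (n + 1)"
    using S by (subst card_Diff_subset) (auto intro: finite_subset)
  then have "(real q - real n - 1) * curve_norm n f x = (\<Sum>j\<in>{1..q} - S. f m x)"
    using q m by (simp add: of_nat_diff)
  also have "\<dots> \<le> (\<Sum>j\<in>{1..q} - S. P j)"
    using S(1) m by (intro sum_mono P) (auto simp: Z_def)
  finally have "(\<Sum>i=0..n. f i x) + (real q - real n - 1) * curve_norm n f x \<le> (\<Sum>j=1..q. P j)"
    using inside sum.subset_diff[OF S(2), of P] by simp
  then show ?thesis by (simp add: P_def sum.distrib)
qed

section \<open>The second main theorem\<close>

text \<open>
  Jensen's formula writes the difference of the two sides as
  \<open>G r / 2 + G (- r) / 2 - G 0\<close> for the function \<open>G\<close> below, which the pointwise bounds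
  estimate from below by a constant.
\<close>

theorem theorem1p9:
  fixes n q :: nat
    and f :: "nat \<Rightarrow> real \<Rightarrow> real"
    and a :: "nat \<Rightarrow> nat \<Rightarrow> ereal"
  assumes "n \<ge> 1" and "q \<ge> 1"
    and "q = 1 \<or> q \<ge> n + 1"
    and "reduced_rep n f"
    and "linearly_nondegenerate n (trop_curve n f)"
    and "\<And>j. j \<in> {1..q} \<Longrightarrow> a j \<in> trop_vec n"
    and "general_position n q (\<lambda>j. trop_hyperplane n (a j))"
  shows "\<exists>C. \<forall>r\<ge>0.
           (real q - real n - 1) * T_char n f r
             \<le> (\<Sum>j=1..q. N_count r (\<lambda>x. - comp_curve n (a j) f x))
               - (\<Sum>j=0..n. N_count r (\<lambda>x. - f j x)) + C"
proof -
  have f: "slope_convex (f i)" if "i \<le> n" for i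
    using assms(4) that by (auto simp: reduced_rep_def intro: trop_entire_slope_convex)
  define d where "d = real q - real n - 1"
  define G where "G x = (\<Sum>j=1..q. comp_curve n (a j) f x) - (\<Sum>i=0..n. f i x) - d * curve_norm n f x"
    for x
  define A where "A = (\<Sum>j=1..q. \<Sum>k\<le>n. \<bar>real_of_ereal (a j k)\<bar>)"
  have G: "- A \<le> G x" for x
    using assms(3)
  proof
    assume "q = 1"
    then show ?thesis
      using pointwise_bound_single[OF assms(6)[of 1], of f x] by (simp add: G_def A_def d_def)
  next
    assume "q \<ge> n + 1"
    from pointwise_bound[OF assms(1) this assms(6,7), of f x]
    show ?thesis unfolding G_def A_def d_def by linarith
  qed
  have "d * T_char n f r \<le> (\<Sum>j=1..q. N_count r (\<lambda>x. - comp_curve n (a j) f x))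
               - (\<Sum>j=0..n. N_count r (\<lambda>x. - f j x)) + (G 0 + A)" if r: "r \<ge> 0" for r
  proof -
    have P: "(\<Sum>j=1..q. N_count r (\<lambda>x. - comp_curve n (a j) f x)) =
        1 / 2 * ((\<Sum>j=1..q. comp_curve n (a j) f r) + (\<Sum>j=1..q. comp_curve n (a j) f (- r)))
        - (\<Sum>j=1..q. comp_curve n (a j) f 0)"
      using slope_convex_comp_curve[OF assms(6) f]
      by (simp add: tropical_Jensen[OF _ r] sum.distrib sum_subtractf sum_divide_distrib[symmetric])
    have F: "(\<Sum>j=0..n. N_count r (\<lambda>x. - f j x)) =
        1 / 2 * ((\<Sum>j=0..n. f j r) + (\<Sum>j=0..n. f j (- r))) - (\<Sum>j=0..n. f j 0)"
      using f by (simp add: tropical_Jensen[OF _ r] sum.distrib sum_subtractf sum_divide_distrib[symmetric])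
    have T: "d * T_char n f r =
        1 / 2 * (d * curve_norm n f r + d * curve_norm n f (- r)) - d * curve_norm n f 0"
      by (simp add: T_char_def algebra_simps)
    show ?thesis unfolding P F T using G[of r] G[of "- r"] unfolding G_def by argo
  qed
  then show ?thesis unfolding d_def by blast
qed

end
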